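(* Let $L:\mathcal{B}\to\mathcal{A}$ be a functor with a right adjoint $R:\mathcal{A}\to\mathcal{B}$ (with unit $\eta$ and counit $\epsilon$), and let $(G,\Delta,\varepsilon)$ be any comonad on $\mathcal{A}$. Consider a functor $K_\varphi:\mathcal{B}\to\mathcal{A}_G$ such that $UK_\varphi=L$, with corresponding morphism of comonads $\varphi:LR\to G$, and let $\alpha=R\varphi\circ\eta R:R\to RG$. Suppose that for every $G$-coalgebra $(X,x)$ the equalizer of $\alpha_X,Rx:RX\to RGX$ exists in $\mathcal{B}$. Then the right adjoint $D_\varphi:\mathcal{A}_G\to\mathcal{B}$ of $K_\varphi$ is full and faithful if and only if $L$ preserves the equalizers of the form $$D_\varphi X\xrightarrow{\;eq_X\;}RX\;\overset{\alpha_X}{\underset{Rx}{\rightrightarrows}}\;RGX\qquad((X,x)\text{ a }G\text{-coalgebra})$$ and $\varphi$ is an isomorphism of comonads.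
   Context: A comonad $(G,\Delta,\varepsilon)$ on $\mathcal{A}$ is a functor $G:\mathcal{A}\to\mathcal{A}$ with natural transformations $\Delta:G\to G^2$, $\varepsilon:G\to id_{\mathcal{A}}$ such that $G\Delta\circ\Delta=\Delta G\circ\Delta$ and $\varepsilon G\circ\Delta=id_G=G\varepsilon\circ\Delta$. The category $\mathcal{A}_G$ of $G$-coalgebras has as objects the pairs $(X,x)$ with $x:X\to GX$ in $\mathcal{A}$ such that $Gx\circ x=\Delta_X\circ x$ and $\varepsilon_X\circ x=id_X$; morphisms $(X,x)\to(X',x')$ are the $f:X\to X'$ in $\mathcal{A}$ with $Gf\circ x=x'\circ f$. $U:\mathcal{A}_G\to\mathcal{A}$ is the forgetful functor. $LR$ is regarded as the comonad $(LR,\delta,\epsilon)$ with $\delta=L\eta R$. A morphism of comonads $\varphi:LR\to G$ is a natural transformation with $\Delta\circ\varphi=\varphi^2\circ\delta$ and $\varepsilon\circ\varphi=\epsilon$, where $\varphi^2_X=\varphi_{GX}\circ LR\varphi_X$. Functors $K:\mathcal{B}\to\mathcal{A}_G$ with $UK=L$ correspond bijectively to morphisms of comonads $\varphi:LR\to G$: the functor $K_\varphi$ corresponding to $\varphi$ is $K_\varphi Y=(LY,\varphi_{LY}\circ L\eta_Y)$ on objects and $K_\varphi f=Lf$ on morphisms. Under the stated assumption on equalizers, $K_\varphi$ has a right adjoint $D_\varphi:\mathcal{A}_G\to\mathcal{B}$ whose value at $(X,x)$ is the equalizer displayed in the claim. *)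

theory Defs
  imports Main
begin

record ('o, 'm) cat =
  Obj :: "'o set"
  Arr :: "'m set"
  Dom :: "'m \<Rightarrow> 'o"
  Cod :: "'m \<Rightarrow> 'o"
  Id :: "'o \<Rightarrow> 'm"
  Comp :: "'m \<Rightarrow> 'm \<Rightarrow> 'm"  (infixr "\<cdot>\<index>" 70)

definition hom :: "('o, 'm) cat \<Rightarrow> 'o \<Rightarrow> 'o \<Rightarrow> 'm set" where
  "hom C X Y = {f \<in> Arr C. Dom C f = X \<and> Cod C f = Y}"

locale category =
  fixes C :: "('o, 'm) cat" (structure)
  assumes Dom_in: "f \<in> Arr C \<Longrightarrow> Dom C f \<in> Obj C"
    and Cod_in: "f \<in> Arr C \<Longrightarrow> Cod C f \<in> Obj C"
    and Id_in: "X \<in> Obj C \<Longrightarrow> Id C X \<in> hom C X X"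
    and Comp_in: "f \<in> hom C X Y \<Longrightarrow> g \<in> hom C Y Z \<Longrightarrow> g \<cdot> f \<in> hom C X Z"
    and Comp_Id: "f \<in> hom C X Y \<Longrightarrow> f \<cdot> Id C X = f"
    and Id_Comp: "f \<in> hom C X Y \<Longrightarrow> Id C Y \<cdot> f = f"
    and Comp_assoc: "f \<in> hom C W X \<Longrightarrow> g \<in> hom C X Y \<Longrightarrow> h \<in> hom C Y Z \<Longrightarrow>
      (h \<cdot> g) \<cdot> f = h \<cdot> (g \<cdot> f)"

text \<open>Functors are pairs of total functions; only their values on the objects and arrows of
  the source category matter, so they are compared by \<open>func_eq\<close> rather than by \<open>=\<close>.\<close>

record ('o, 'm, 'p, 'n) func =
  omap :: "'o \<Rightarrow> 'p"
  amap :: "'m \<Rightarrow> 'n"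

locale cat_functor = dom: category C + cod: category D
  for C :: "('o, 'm) cat" and D :: "('p, 'n) cat" and F :: "('o, 'm, 'p, 'n) func" +
  assumes omap_in: "X \<in> Obj C \<Longrightarrow> omap F X \<in> Obj D"
    and amap_in: "f \<in> hom C X Y \<Longrightarrow> amap F f \<in> hom D (omap F X) (omap F Y)"
    and amap_Id: "X \<in> Obj C \<Longrightarrow> amap F (Id C X) = Id D (omap F X)"
    and amap_Comp: "f \<in> hom C X Y \<Longrightarrow> g \<in> hom C Y Z \<Longrightarrow>
      amap F (g \<cdot>\<^bsub>C\<^esub> f) = amap F g \<cdot>\<^bsub>D\<^esub> amap F f"

definition func_eq ::
  "('o, 'm) cat \<Rightarrow> ('o, 'm, 'p, 'n) func \<Rightarrow> ('o, 'm, 'p, 'n) func \<Rightarrow> bool" where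
  "func_eq C F F' \<longleftrightarrow>
    (\<forall>X \<in> Obj C. omap F X = omap F' X) \<and> (\<forall>f \<in> Arr C. amap F f = amap F' f)"

definition id_func :: "('o, 'm, 'o, 'm) func" where
  "id_func = \<lparr>omap = (\<lambda>X. X), amap = (\<lambda>f. f)\<rparr>"

definition comp_func ::
  "('p, 'n, 'q, 'k) func \<Rightarrow> ('o, 'm, 'p, 'n) func \<Rightarrow> ('o, 'm, 'q, 'k) func"
  (infixr "\<circ>\<^sub>F" 75) where
  "F \<circ>\<^sub>F F' = \<lparr>omap = omap F \<circ> omap F', amap = amap F \<circ> amap F'\<rparr>"

definition full :: "('o, 'm) cat \<Rightarrow> ('p, 'n) cat \<Rightarrow> ('o, 'm, 'p, 'n) func \<Rightarrow> bool" where
  "full C D F \<longleftrightarrow>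
    (\<forall>X \<in> Obj C. \<forall>Y \<in> Obj C. amap F ` hom C X Y = hom D (omap F X) (omap F Y))"

definition faithful :: "('o, 'm) cat \<Rightarrow> ('o, 'm, 'p, 'n) func \<Rightarrow> bool" where
  "faithful C F \<longleftrightarrow> (\<forall>X \<in> Obj C. \<forall>Y \<in> Obj C. inj_on (amap F) (hom C X Y))"

definition nat_trans :: "('o, 'm) cat \<Rightarrow> ('p, 'n) cat \<Rightarrow>
    ('o, 'm, 'p, 'n) func \<Rightarrow> ('o, 'm, 'p, 'n) func \<Rightarrow> ('o \<Rightarrow> 'n) \<Rightarrow> bool" where
  "nat_trans C D F F' t \<longleftrightarrow>
    (\<forall>X \<in> Obj C. t X \<in> hom D (omap F X) (omap F' X)) \<and>
    (\<forall>X Y. \<forall>f \<in> hom C X Y. t Y \<cdot>\<^bsub>D\<^esub> amap F f = amap F' f \<cdot>\<^bsub>D\<^esub> t X)"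

locale adjunction = L: cat_functor B A L + R: cat_functor A B R
  for B :: "('b, 'g) cat" and A :: "('a, 'f) cat"
    and L :: "('b, 'g, 'a, 'f) func" and R :: "('a, 'f, 'b, 'g) func"
    and eta :: "'b \<Rightarrow> 'g" and epsilon :: "'a \<Rightarrow> 'f" +
  assumes unit: "nat_trans B B id_func (R \<circ>\<^sub>F L) eta"
    and counit: "nat_trans A A (L \<circ>\<^sub>F R) id_func epsilon"
    and triangle_L: "Y \<in> Obj B \<Longrightarrow>
      epsilon (omap L Y) \<cdot>\<^bsub>A\<^esub> amap L (eta Y) = Id A (omap L Y)"
    and triangle_R: "X \<in> Obj A \<Longrightarrow>
      amap R (epsilon X) \<cdot>\<^bsub>B\<^esub> eta (omap R X) = Id B (omap R X)"

definition right_adjoint :: "('b, 'g) cat \<Rightarrow> ('a, 'f) cat \<Rightarrow>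
    ('b, 'g, 'a, 'f) func \<Rightarrow> ('a, 'f, 'b, 'g) func \<Rightarrow> bool" where
  "right_adjoint B A L R \<longleftrightarrow> (\<exists>eta epsilon. adjunction B A L R eta epsilon)"

definition is_equalizer :: "('o, 'm) cat \<Rightarrow> 'm \<Rightarrow> 'm \<Rightarrow> 'm \<Rightarrow> bool" where
  "is_equalizer C f g e \<longleftrightarrow>
    f \<in> Arr C \<and> g \<in> hom C (Dom C f) (Cod C f) \<and>
    e \<in> hom C (Dom C e) (Dom C f) \<and> f \<cdot>\<^bsub>C\<^esub> e = g \<cdot>\<^bsub>C\<^esub> e \<and>
    (\<forall>W. \<forall>h \<in> hom C W (Dom C f). f \<cdot>\<^bsub>C\<^esub> h = g \<cdot>\<^bsub>C\<^esub> h \<longrightarrow>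
      (\<exists>!k. k \<in> hom C W (Dom C e) \<and> e \<cdot>\<^bsub>C\<^esub> k = h))"

definition preserves_equalizer :: "('o, 'm) cat \<Rightarrow> ('p, 'n) cat \<Rightarrow>
    ('o, 'm, 'p, 'n) func \<Rightarrow> 'm \<Rightarrow> 'm \<Rightarrow> 'm \<Rightarrow> bool" where
  "preserves_equalizer C D F f g e \<longleftrightarrow>
    (is_equalizer C f g e \<longrightarrow> is_equalizer D (amap F f) (amap F g) (amap F e))"

record ('o, 'm) comonad =
  cfun :: "('o, 'm, 'o, 'm) func"
  comult :: "'o \<Rightarrow> 'm"
  counit :: "'o \<Rightarrow> 'm"

locale comonad_on = cat_functor A A "cfun G"
  for A :: "('o, 'm) cat" and G :: "('o, 'm) comonad" +
  assumes comult: "nat_trans A A (cfun G) (cfun G \<circ>\<^sub>F cfun G) (comult G)"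
    and counit: "nat_trans A A (cfun G) id_func (counit G)"
    and coassoc: "X \<in> Obj A \<Longrightarrow>
      amap (cfun G) (comult G X) \<cdot>\<^bsub>A\<^esub> comult G X =
      comult G (omap (cfun G) X) \<cdot>\<^bsub>A\<^esub> comult G X"
    and counit_left: "X \<in> Obj A \<Longrightarrow>
      counit G (omap (cfun G) X) \<cdot>\<^bsub>A\<^esub> comult G X = Id A (omap (cfun G) X)"
    and counit_right: "X \<in> Obj A \<Longrightarrow>
      amap (cfun G) (counit G X) \<cdot>\<^bsub>A\<^esub> comult G X = Id A (omap (cfun G) X)"

definition comonad_morphism :: "('o, 'm) cat \<Rightarrow>
    ('o, 'm) comonad \<Rightarrow> ('o, 'm) comonad \<Rightarrow> ('o \<Rightarrow> 'm) \<Rightarrow> bool" where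
  "comonad_morphism A H G phi \<longleftrightarrow>
    nat_trans A A (cfun H) (cfun G) phi \<and>
    (\<forall>X \<in> Obj A.
      comult G X \<cdot>\<^bsub>A\<^esub> phi X =
        (phi (omap (cfun G) X) \<cdot>\<^bsub>A\<^esub> amap (cfun H) (phi X)) \<cdot>\<^bsub>A\<^esub> comult H X \<and>
      counit G X \<cdot>\<^bsub>A\<^esub> phi X = counit H X)"

definition comonad_iso :: "('o, 'm) cat \<Rightarrow>
    ('o, 'm) comonad \<Rightarrow> ('o, 'm) comonad \<Rightarrow> ('o \<Rightarrow> 'm) \<Rightarrow> bool" where
  "comonad_iso A H G phi \<longleftrightarrow> comonad_morphism A H G phi \<and>
    (\<exists>psi. comonad_morphism A G H psi \<and>
      (\<forall>X \<in> Obj A. psi X \<cdot>\<^bsub>A\<^esub> phi X = Id A (omap (cfun H) X) \<and>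
                  phi X \<cdot>\<^bsub>A\<^esub> psi X = Id A (omap (cfun G) X)))"

definition adj_comonad :: "('b, 'g, 'a, 'f) func \<Rightarrow> ('a, 'f, 'b, 'g) func \<Rightarrow>
    ('b \<Rightarrow> 'g) \<Rightarrow> ('a \<Rightarrow> 'f) \<Rightarrow> ('a, 'f) comonad" where
  "adj_comonad L R eta epsilon =
    \<lparr>cfun = L \<circ>\<^sub>F R, comult = (\<lambda>X. amap L (eta (omap R X))), counit = epsilon\<rparr>"

definition coalgebras :: "('o, 'm) cat \<Rightarrow> ('o, 'm) comonad \<Rightarrow> ('o \<times> 'm) set" where
  "coalgebras A G = {(X, x). X \<in> Obj A \<and> x \<in> hom A X (omap (cfun G) X) \<and>
    amap (cfun G) x \<cdot>\<^bsub>A\<^esub> x = comult G X \<cdot>\<^bsub>A\<^esub> x \<and> counit G X \<cdot>\<^bsub>A\<^esub> x = Id A X}"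

text \<open>Arrows of the category of coalgebras carry their source and target coalgebra, since the
  same arrow of the base category may underlie several coalgebra morphisms.\<close>

definition coalg_cat :: "('o, 'm) cat \<Rightarrow> ('o, 'm) comonad \<Rightarrow>
    ('o \<times> 'm, ('o \<times> 'm) \<times> 'm \<times> ('o \<times> 'm)) cat" where
  "coalg_cat A G =
    \<lparr>Obj = coalgebras A G,
     Arr = {((X, x), f, (X', x')). (X, x) \<in> coalgebras A G \<and> (X', x') \<in> coalgebras A G \<and>
              f \<in> hom A X X' \<and> amap (cfun G) f \<cdot>\<^bsub>A\<^esub> x = x' \<cdot>\<^bsub>A\<^esub> f},
     Dom = (\<lambda>(P, f, Q). P),
     Cod = (\<lambda>(P, f, Q). Q),
     Id = (\<lambda>(X, x). ((X, x), Id A X, (X, x))),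
     Comp = (\<lambda>(P', g, Q') (P, f, Q). (P, g \<cdot>\<^bsub>A\<^esub> f, Q'))\<rparr>"

definition forget_func :: "('o \<times> 'm, ('o \<times> 'm) \<times> 'm \<times> ('o \<times> 'm), 'o, 'm) func" where
  "forget_func = \<lparr>omap = (\<lambda>(X, x). X), amap = (\<lambda>(P, f, Q). f)\<rparr>"

definition K_obj :: "('a, 'f) cat \<Rightarrow> ('b, 'g, 'a, 'f) func \<Rightarrow> ('b \<Rightarrow> 'g) \<Rightarrow>
    ('a \<Rightarrow> 'f) \<Rightarrow> 'b \<Rightarrow> 'a \<times> 'f" where
  "K_obj A L eta phi Y = (omap L Y, phi (omap L Y) \<cdot>\<^bsub>A\<^esub> amap L (eta Y))"

definition K_func :: "('b, 'g) cat \<Rightarrow> ('a, 'f) cat \<Rightarrow> ('b, 'g, 'a, 'f) func \<Rightarrow>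
    ('b \<Rightarrow> 'g) \<Rightarrow> ('a \<Rightarrow> 'f) \<Rightarrow> ('b, 'g, 'a \<times> 'f, ('a \<times> 'f) \<times> 'f \<times> ('a \<times> 'f)) func" where
  "K_func B A L eta phi =
    \<lparr>omap = K_obj A L eta phi,
     amap = (\<lambda>f. (K_obj A L eta phi (Dom B f), amap L f, K_obj A L eta phi (Cod B f)))\<rparr>"

definition alpha :: "('b, 'g) cat \<Rightarrow> ('a, 'f, 'b, 'g) func \<Rightarrow> ('b \<Rightarrow> 'g) \<Rightarrow>
    ('a \<Rightarrow> 'f) \<Rightarrow> 'a \<Rightarrow> 'g" where
  "alpha B R eta phi X = amap R (phi X) \<cdot>\<^bsub>B\<^esub> eta (omap R X)"

end

theory Submission
  imports Defs
begin

text \<open>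
  The right adjoint \<open>D\<close> is full and faithful exactly when the counit of \<open>K \<stileturn> D\<close> is invertible
  at every coalgebra (\<open>full_faithful_iff_counit_iso\<close>), so the proof identifies this counit.

  Transposition along \<open>L \<stileturn> R\<close> turns coalgebra morphisms \<open>K Y \<rightarrow> (X, x)\<close> into arrows \<open>Y \<rightarrow> R X\<close>
  that equalize \<open>alpha X\<close> and \<open>R x\<close>. Hence every equalizer \<open>d\<close> of this pair yields a couniversal
  arrow \<open>epsilon X \<cdot> L d\<close> from \<open>K\<close> to \<open>(X, x)\<close> (\<open>equalizer_couniversal\<close>). Couniversal arrows to the
  same object are invertible together (\<open>couniversal_iso\<close>), so the counit at \<open>(X, x)\<close> may be tested
  on any convenient \<open>d\<close>.

  At a cofree coalgebra \<open>(G X, comult X)\<close> the arrow \<open>alpha X\<close> is a split equalizer, and the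
  couniversal arrow that it yields is \<open>phi X\<close>. Thus if \<open>D\<close> is full and faithful, every component
  of \<open>phi\<close> is invertible, and this already makes \<open>phi\<close> an isomorphism of comonads
  (\<open>comonad_iso_iff\<close>).

  Once \<open>phi\<close> is invertible, it carries the pair \<open>L (alpha X), L (R x)\<close> to the pair
  \<open>comult X, G x\<close>, whose equalizer is \<open>x\<close> for every coalgebra. The arrow compared with \<open>x\<close> in
  this way is again \<open>epsilon X \<cdot> L d\<close>, so \<open>L\<close> preserves the equalizer \<open>d\<close> exactly when the counit at
  \<open>(X, x)\<close> is invertible (\<open>L_equalizer_iff\<close>).
\<close>

section \<open>Composition and isomorphisms\<close>

context category
begin

lemma Dom_Obj [simp]: "f \<in> Arr C \<Longrightarrow> Dom C f \<in> Obj C"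
  and Cod_Obj [simp]: "f \<in> Arr C \<Longrightarrow> Cod C f \<in> Obj C"
  by (auto intro: Dom_in Cod_in)

lemma Id_arr [simp]:
  assumes "X \<in> Obj C"
  shows "Id C X \<in> Arr C" "Dom C (Id C X) = X" "Cod C (Id C X) = X"
  using Id_in[OF assms] by (auto simp: hom_def)

lemma Comp_arr [simp]:
  assumes "f \<in> Arr C" "g \<in> Arr C" "Dom C g = Cod C f"
  shows "g \<cdot> f \<in> Arr C" "Dom C (g \<cdot> f) = Dom C f" "Cod C (g \<cdot> f) = Cod C g"
  using Comp_in[of f "Dom C f" "Cod C f" g "Cod C g"] assms by (auto simp: hom_def)

lemma Comp_Id_right [simp]: "f \<in> Arr C \<Longrightarrow> Dom C f = X \<Longrightarrow> f \<cdot> Id C X = f"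
  by (rule Comp_Id[of f X "Cod C f"]) (simp add: hom_def)

lemma Comp_Id_left [simp]: "f \<in> Arr C \<Longrightarrow> Cod C f = X \<Longrightarrow> Id C X \<cdot> f = f"
  by (rule Id_Comp[of f "Dom C f" X]) (simp add: hom_def)

lemma Comp_Comp [simp]:
  "f \<in> Arr C \<Longrightarrow> g \<in> Arr C \<Longrightarrow> h \<in> Arr C \<Longrightarrow> Dom C g = Cod C f \<Longrightarrow> Dom C h = Cod C g \<Longrightarrow>
    (h \<cdot> g) \<cdot> f = h \<cdot> (g \<cdot> f)"
  by (rule Comp_assoc[of f "Dom C f" "Cod C f" g "Cod C g" h "Cod C h"]) (auto simp: hom_def)

text \<open>With composites normalised to the right, a relation between two-step paths applies inside a
  longer path only in this prolonged form.\<close>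

lemma square_Comp:
  assumes "g \<cdot> f = q \<cdot> p" "r \<in> Arr C" "f \<in> Arr C" "g \<in> Arr C" "p \<in> Arr C" "q \<in> Arr C"
    "Dom C g = Cod C f" "Dom C q = Cod C p" "Dom C f = Cod C r" "Dom C p = Cod C r"
  shows "g \<cdot> (f \<cdot> r) = q \<cdot> (p \<cdot> r)"
proof -
  have "g \<cdot> (f \<cdot> r) = (g \<cdot> f) \<cdot> r" using assms(2-) by simp
  also have "\<dots> = q \<cdot> (p \<cdot> r)" unfolding assms(1) using assms(2-) by simp
  finally show ?thesis .
qed

lemma triangle_Comp:
  assumes "g \<cdot> f = p" "r \<in> Arr C" "f \<in> Arr C" "g \<in> Arr C" "Dom C g = Cod C f" "Dom C f = Cod C r"
  shows "g \<cdot> (f \<cdot> r) = p \<cdot> r"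
proof -
  have "g \<cdot> (f \<cdot> r) = (g \<cdot> f) \<cdot> r" using assms(2-) by simp
  then show ?thesis using assms(1) by simp
qed

lemma cancel_Comp:
  assumes "g \<cdot> f = Id C X" "r \<in> Arr C" "f \<in> Arr C" "g \<in> Arr C" "Dom C g = Cod C f"
    "Dom C f = Cod C r" "Cod C r = X"
  shows "g \<cdot> (f \<cdot> r) = r"
  using triangle_Comp[OF assms(1-6)] assms(2,7) by simp

end

definition iso_arr :: "('o, 'm) cat \<Rightarrow> 'm \<Rightarrow> bool" where
  "iso_arr C f \<longleftrightarrow> f \<in> Arr C \<and> (\<exists>g \<in> hom C (Cod C f) (Dom C f).
    g \<cdot>\<^bsub>C\<^esub> f = Id C (Dom C f) \<and> f \<cdot>\<^bsub>C\<^esub> g = Id C (Cod C f))"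

lemma iso_arrE:
  assumes "iso_arr C f"
  obtains g where "f \<in> Arr C" "g \<in> Arr C" "Dom C g = Cod C f" "Cod C g = Dom C f"
    "g \<cdot>\<^bsub>C\<^esub> f = Id C (Dom C f)" "f \<cdot>\<^bsub>C\<^esub> g = Id C (Cod C f)"
  using assms by (auto simp: iso_arr_def hom_def)

lemma iso_arrI:
  assumes "f \<in> Arr C" "g \<in> Arr C" "Dom C g = Cod C f" "Cod C g = Dom C f"
    "g \<cdot>\<^bsub>C\<^esub> f = Id C (Dom C f)" "f \<cdot>\<^bsub>C\<^esub> g = Id C (Cod C f)"
  shows "iso_arr C f"
  using assms by (auto simp: iso_arr_def hom_def)

lemma (in category) iso_cancel:
  assumes "iso_arr C f" "h \<in> Arr C" "k \<in> Arr C" "Cod C h = Dom C f" "Cod C k = Dom C f"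
    "f \<cdot> h = f \<cdot> k"
  shows "h = k"
proof -
  from assms(1) obtain g where g: "f \<in> Arr C" "g \<in> Arr C" "Dom C g = Cod C f"
    "Cod C g = Dom C f" "g \<cdot> f = Id C (Dom C f)" by (rule iso_arrE)
  have "g \<cdot> (f \<cdot> h) = h" using triangle_Comp[OF g(5), of h] g assms(2-5) by simp
  moreover have "g \<cdot> (f \<cdot> k) = k" using triangle_Comp[OF g(5), of k] g assms(2-5) by simp
  ultimately show ?thesis using assms(6) by metis
qed

section \<open>Equalizers\<close>

context category
begin

lemma equalizerD:
  assumes "is_equalizer C f g e"
  shows "f \<in> Arr C" "g \<in> Arr C" "e \<in> Arr C" "Dom C g = Dom C f" "Cod C g = Cod C f"
    "Cod C e = Dom C f" "f \<cdot> e = g \<cdot> e"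
  using assms by (auto simp: is_equalizer_def hom_def)

lemma equalizer_ex1:
  assumes "is_equalizer C f g e" "h \<in> hom C W (Dom C f)" "f \<cdot> h = g \<cdot> h"
  shows "\<exists>!k. k \<in> hom C W (Dom C e) \<and> e \<cdot> k = h"
proof -
  have "\<forall>W. \<forall>h \<in> hom C W (Dom C f). f \<cdot> h = g \<cdot> h \<longrightarrow> (\<exists>!k. k \<in> hom C W (Dom C e) \<and> e \<cdot> k = h)"
    using assms(1) unfolding is_equalizer_def by (elim conjE)
  from this[rule_format, OF assms(2,3)] show ?thesis .
qed

lemma equalizer_factor:
  assumes "is_equalizer C f g e" "h \<in> Arr C" "Cod C h = Dom C f" "f \<cdot> h = g \<cdot> h"
  obtains k where "k \<in> Arr C" "Dom C k = Dom C h" "Cod C k = Dom C e" "e \<cdot> k = h"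
proof -
  have "h \<in> hom C (Dom C h) (Dom C f)" using assms by (simp add: hom_def)
  from equalizer_ex1[OF assms(1) this assms(4)] obtain k
    where "k \<in> hom C (Dom C h) (Dom C e)" "e \<cdot> k = h" by blast
  then show ?thesis by (intro that[of k]) (simp_all add: hom_def)
qed

lemma equalizer_mono:
  assumes e: "is_equalizer C f g e" and "h \<in> Arr C" "k \<in> Arr C" "Dom C h = Dom C k"
    "Cod C h = Dom C e" "Cod C k = Dom C e" "e \<cdot> h = e \<cdot> k"
  shows "h = k"
proof -
  note D = equalizerD[OF e]
  have "f \<cdot> (e \<cdot> h) = g \<cdot> (e \<cdot> h)"
    by (rule square_Comp[OF D(7)]) (use D(1-6) assms(2-6) in simp_all)
  moreover have "e \<cdot> h \<in> hom C (Dom C h) (Dom C f)"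
    using D(1-6) assms(2-6) by (simp add: hom_def)
  ultimately have "\<exists>!l. l \<in> hom C (Dom C h) (Dom C e) \<and> e \<cdot> l = e \<cdot> h"
    by (intro equalizer_ex1[OF e])
  moreover have "h \<in> hom C (Dom C h) (Dom C e)" "k \<in> hom C (Dom C h) (Dom C e)"
    using assms by (simp_all add: hom_def)
  ultimately show ?thesis using assms(7) by metis
qed

lemma equalizerI:
  assumes "f \<in> Arr C" "g \<in> Arr C" "e \<in> Arr C" "Dom C g = Dom C f" "Cod C g = Cod C f"
    "Cod C e = Dom C f" "f \<cdot> e = g \<cdot> e"
    and factor: "\<And>h. h \<in> Arr C \<Longrightarrow> Cod C h = Dom C f \<Longrightarrow> f \<cdot> h = g \<cdot> h \<Longrightarrow>
      \<exists>k \<in> hom C (Dom C h) (Dom C e). e \<cdot> k = h"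
    and mono: "\<And>h k. h \<in> Arr C \<Longrightarrow> k \<in> Arr C \<Longrightarrow> Dom C h = Dom C k \<Longrightarrow> Cod C h = Dom C e \<Longrightarrow>
      Cod C k = Dom C e \<Longrightarrow> e \<cdot> h = e \<cdot> k \<Longrightarrow> h = k"
  shows "is_equalizer C f g e"
  unfolding is_equalizer_def
proof (intro conjI allI ballI impI)
  fix W h assume h: "h \<in> hom C W (Dom C f)" "f \<cdot> h = g \<cdot> h"
  then obtain k where "k \<in> hom C W (Dom C e)" "e \<cdot> k = h"
    using factor[of h] by (auto simp: hom_def)
  then show "\<exists>!k. k \<in> hom C W (Dom C e) \<and> e \<cdot> k = h"
    using mono by (auto simp: hom_def)
qed (use assms in \<open>auto simp: hom_def\<close>)

text \<open>A contractible fork is an equalizer: the retraction \<open>r\<close> of \<open>e\<close> supplies the factorisation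
  \<open>r \<cdot> h\<close>, and the retraction \<open>s\<close> of \<open>g\<close> shows that it works.\<close>

lemma split_equalizer:
  assumes "f \<in> Arr C" "g \<in> Arr C" "e \<in> Arr C" "Dom C g = Dom C f" "Cod C g = Cod C f"
    "Cod C e = Dom C f" and fork: "f \<cdot> e = g \<cdot> e"
    and r: "r \<in> hom C (Dom C f) (Dom C e)" "r \<cdot> e = Id C (Dom C e)"
    and s: "s \<in> hom C (Cod C f) (Dom C f)" "s \<cdot> g = Id C (Dom C f)" "s \<cdot> f = e \<cdot> r"
  shows "is_equalizer C f g e"
proof (rule equalizerI)
  note a = assms(1-6) r(1)[unfolded hom_def, simplified] s(1)[unfolded hom_def, simplified]
  fix h assume h: "h \<in> Arr C" "Cod C h = Dom C f" "f \<cdot> h = g \<cdot> h"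
  have "e \<cdot> (r \<cdot> h) = s \<cdot> (f \<cdot> h)"
    by (rule square_Comp[OF s(3)[symmetric]]) (use a h(1,2) in simp_all)
  also have "\<dots> = h" unfolding h(3) by (rule cancel_Comp[OF s(2)]) (use a h(1,2) in simp_all)
  finally show "\<exists>k \<in> hom C (Dom C h) (Dom C e). e \<cdot> k = h"
    using a h(1,2) by (intro bexI[of _ "r \<cdot> h"]) (simp_all add: hom_def)
next
  note a = assms(1-6) r(1)[unfolded hom_def, simplified]
  fix h k assume h: "h \<in> Arr C" "k \<in> Arr C" "Dom C h = Dom C k" "Cod C h = Dom C e"
    "Cod C k = Dom C e" "e \<cdot> h = e \<cdot> k"
  have "r \<cdot> (e \<cdot> h) = h" by (rule cancel_Comp[OF r(2)]) (use a h(1-5) in simp_all)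
  moreover have "r \<cdot> (e \<cdot> k) = k" by (rule cancel_Comp[OF r(2)]) (use a h(1-5) in simp_all)
  ultimately show "h = k" using h(6) by metis
qed (use assms(1-6) fork in simp_all)

text \<open>A parallel pair \<open>(f, g)\<close> is compared with a second pair \<open>(f', g')\<close> that has a known
  equalizer \<open>e\<close>, along an isomorphism \<open>u\<close> on sources and a monomorphism \<open>v\<close> on targets. Since
  \<open>u\<close> then carries the arrows equalized by \<open>(f, g)\<close> bijectively to those equalized by \<open>(f', g')\<close>,
  an arrow \<open>d\<close> is an equalizer exactly when the induced \<open>s\<close> is invertible.\<close>

lemma equalizer_iff_comparison_iso:
  assumes e: "is_equalizer C f' g' e"
    and fg: "f \<in> Arr C" "g \<in> Arr C" "Dom C g = Dom C f" "Cod C g = Cod C f"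
    and u: "iso_arr C u" "Dom C u = Dom C f" "Cod C u = Dom C f'"
    and v: "iso_arr C v" "Dom C v = Cod C f" "Cod C v = Cod C f'"
    and sq: "v \<cdot> f = f' \<cdot> u" "v \<cdot> g = g' \<cdot> u"
    and d: "d \<in> Arr C" "Cod C d = Dom C f"
    and s: "s \<in> hom C (Dom C d) (Dom C e)" "u \<cdot> d = e \<cdot> s"
  shows "is_equalizer C f g d \<longleftrightarrow> iso_arr C s"
proof -
  note E = equalizerD[OF e]
  have s': "s \<in> Arr C" "Dom C s = Dom C d" "Cod C s = Dom C e"
    using s(1) by (simp_all add: hom_def)
  obtain u' where u': "u \<in> Arr C" "u' \<in> Arr C" "Dom C u' = Cod C u" "Cod C u' = Dom C u"
    "u' \<cdot> u = Id C (Dom C u)" "u \<cdot> u' = Id C (Cod C u)" using u(1) by (rule iso_arrE)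
  have v': "v \<in> Arr C" using v(1) by (simp add: iso_arr_def)
  note a = E(1-6) fg u(2,3) v(2,3) v' d s' u'(1-4)
  have equalized_iff: "f \<cdot> h = g \<cdot> h \<longleftrightarrow> f' \<cdot> (u \<cdot> h) = g' \<cdot> (u \<cdot> h)"
    if h: "h \<in> Arr C" "Cod C h = Dom C f" for h
  proof -
    have "v \<cdot> (f \<cdot> h) = f' \<cdot> (u \<cdot> h)" by (rule square_Comp[OF sq(1)]) (use a h in simp_all)
    moreover have "v \<cdot> (g \<cdot> h) = g' \<cdot> (u \<cdot> h)" by (rule square_Comp[OF sq(2)]) (use a h in simp_all)
    moreover have "v \<cdot> (f \<cdot> h) = v \<cdot> (g \<cdot> h) \<longleftrightarrow> f \<cdot> h = g \<cdot> h"
      using iso_cancel[OF v(1), of "f \<cdot> h" "g \<cdot> h"] a h by auto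
    ultimately show ?thesis by simp
  qed
  show ?thesis
  proof
    assume D: "is_equalizer C f g d"
    have ue: "u \<cdot> (u' \<cdot> e) = e" by (rule cancel_Comp[OF u'(6)]) (use a in simp_all)
    have "f \<cdot> (u' \<cdot> e) = g \<cdot> (u' \<cdot> e)"
      using equalized_iff[of "u' \<cdot> e"] ue E(7) a by (simp del: Comp_Comp)
    moreover have ue_arr: "u' \<cdot> e \<in> Arr C" "Cod C (u' \<cdot> e) = Dom C f" "Dom C (u' \<cdot> e) = Dom C e"
      using a by simp_all
    ultimately obtain t where t: "t \<in> Arr C" "Dom C t = Dom C e" "Cod C t = Dom C d"
        "d \<cdot> t = u' \<cdot> e"
      using equalizer_factor[OF D ue_arr(1,2)] by metis
    have "e \<cdot> (s \<cdot> t) = u \<cdot> (d \<cdot> t)"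
      by (rule square_Comp[OF s(2)[symmetric]]) (use a t in simp_all)
    also have "\<dots> = e" using ue t(4) by simp
    finally have st: "s \<cdot> t = Id C (Dom C e)"
      using equalizer_mono[OF e, of "s \<cdot> t" "Id C (Dom C e)"] a t(1-3) by simp
    have "d \<cdot> (t \<cdot> s) = u' \<cdot> (u \<cdot> d)"
      unfolding s(2) by (rule square_Comp[OF t(4)]) (use a t(1-3) in simp_all)
    also have "\<dots> = d" by (rule cancel_Comp[OF u'(5)]) (use a in simp_all)
    finally have ts: "t \<cdot> s = Id C (Dom C d)"
      using equalizer_mono[OF D, of "t \<cdot> s" "Id C (Dom C d)"] a t(1-3) by simp
    show "iso_arr C s" using st ts a t(1-3) by (intro iso_arrI[of s C t]) simp_all
  next
    assume S: "iso_arr C s"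
    then obtain t where t: "t \<in> Arr C" "Dom C t = Cod C s" "Cod C t = Dom C s"
      "s \<cdot> t = Id C (Cod C s)" by (rule iso_arrE)
    show "is_equalizer C f g d"
    proof (rule equalizerI)
      have "f' \<cdot> (e \<cdot> s) = g' \<cdot> (e \<cdot> s)" by (rule square_Comp[OF E(7)]) (use a in simp_all)
      then show "f \<cdot> d = g \<cdot> d" using equalized_iff[of d] d s(2) by simp
    next
      fix h assume h: "h \<in> Arr C" "Cod C h = Dom C f" "f \<cdot> h = g \<cdot> h"
      then have "f' \<cdot> (u \<cdot> h) = g' \<cdot> (u \<cdot> h)" using equalized_iff by simp
      moreover have uh: "u \<cdot> h \<in> Arr C" "Cod C (u \<cdot> h) = Dom C f'" "Dom C (u \<cdot> h) = Dom C h"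
        using a h(1,2) by simp_all
      ultimately obtain k where k: "k \<in> Arr C" "Dom C k = Dom C h" "Cod C k = Dom C e"
          "e \<cdot> k = u \<cdot> h"
        using equalizer_factor[OF e uh(1,2)] by metis
      have "u \<cdot> (d \<cdot> (t \<cdot> k)) = e \<cdot> (s \<cdot> (t \<cdot> k))"
        by (rule square_Comp[OF s(2)]) (use a t(1-3) k(1-3) in simp_all)
      also have "s \<cdot> (t \<cdot> k) = k" by (rule cancel_Comp[OF t(4)]) (use a t(1-3) k(1-3) in simp_all)
      also note k(4)
      finally have "d \<cdot> (t \<cdot> k) = h"
        using iso_cancel[OF u(1), of "d \<cdot> (t \<cdot> k)" h] a t(1-3) k(1-3) h(1,2) by simp
      then show "\<exists>k \<in> hom C (Dom C h) (Dom C d). d \<cdot> k = h"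
        using a t(1-3) k(1-3) by (intro bexI[of _ "t \<cdot> k"]) (simp_all add: hom_def)
    next
      fix h k assume h: "h \<in> Arr C" "k \<in> Arr C" "Dom C h = Dom C k" "Cod C h = Dom C d"
        "Cod C k = Dom C d" "d \<cdot> h = d \<cdot> k"
      have "u \<cdot> (d \<cdot> h) = e \<cdot> (s \<cdot> h)" by (rule square_Comp[OF s(2)]) (use a h(1-5) in simp_all)
      moreover have "u \<cdot> (d \<cdot> k) = e \<cdot> (s \<cdot> k)"
        by (rule square_Comp[OF s(2)]) (use a h(1-5) in simp_all)
      ultimately have "e \<cdot> (s \<cdot> h) = e \<cdot> (s \<cdot> k)" using h(6) by metis
      then have "s \<cdot> h = s \<cdot> k"
        using equalizer_mono[OF e, of "s \<cdot> h" "s \<cdot> k"] a h(1-5) by simp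
      then show "h = k" using iso_cancel[OF S, of h k] a h(1-5) by simp
    qed (use a in simp_all)
  qed
qed

end

section \<open>Functors, adjunctions and couniversal arrows\<close>

context cat_functor
begin

lemma amap_arr [simp]:
  assumes "f \<in> Arr C"
  shows "amap F f \<in> Arr D" "Dom D (amap F f) = omap F (Dom C f)"
    "Cod D (amap F f) = omap F (Cod C f)"
  using amap_in[of f "Dom C f" "Cod C f"] assms by (auto simp: hom_def)

lemma omap_Obj [simp]: "X \<in> Obj C \<Longrightarrow> omap F X \<in> Obj D"
  by (rule omap_in)

lemma amap_Comp_Id [simp]:
  shows "X \<in> Obj C \<Longrightarrow> amap F (Id C X) = Id D (omap F X)"
    and "f \<in> Arr C \<Longrightarrow> g \<in> Arr C \<Longrightarrow> Dom C g = Cod C f \<Longrightarrow>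
      amap F (g \<cdot>\<^bsub>C\<^esub> f) = amap F g \<cdot>\<^bsub>D\<^esub> amap F f"
  using amap_Id amap_Comp[of f "Dom C f" "Cod C f" g "Cod C g"] by (auto simp: hom_def)

lemma amap_triangle:
  assumes "g \<cdot>\<^bsub>C\<^esub> f = h" "f \<in> Arr C" "g \<in> Arr C" "Dom C g = Cod C f"
  shows "amap F g \<cdot>\<^bsub>D\<^esub> amap F f = amap F h"
  using assms amap_Comp_Id(2) by metis

end

lemma nat_trans_arr:
  assumes "nat_trans C D F F' t" "X \<in> Obj C"
  shows "t X \<in> Arr D" "Dom D (t X) = omap F X" "Cod D (t X) = omap F' X"
  using assms by (auto simp: nat_trans_def hom_def)

lemma nat_trans_square:
  assumes "nat_trans C D F F' t" "f \<in> Arr C"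
  shows "t (Cod C f) \<cdot>\<^bsub>D\<^esub> amap F f = amap F' f \<cdot>\<^bsub>D\<^esub> t (Dom C f)"
  using assms by (auto simp: nat_trans_def hom_def)

text \<open>A couniversal arrow to \<open>P\<close> is a terminal object of the comma category of \<open>K\<close> over \<open>P\<close>;
  it is the counit component of a right adjoint, stated for a single object.\<close>

definition couniversal :: "('b, 'g) cat \<Rightarrow> ('a, 'f) cat \<Rightarrow> ('b, 'g, 'a, 'f) func \<Rightarrow>
    'a \<Rightarrow> 'b \<Rightarrow> 'f \<Rightarrow> bool" where
  "couniversal B A K P Y u \<longleftrightarrow> Y \<in> Obj B \<and> u \<in> hom A (omap K Y) P \<and>
    (\<forall>W \<in> Obj B. \<forall>h \<in> hom A (omap K W) P. \<exists>!k. k \<in> hom B W Y \<and> u \<cdot>\<^bsub>A\<^esub> amap K k = h)"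

lemma couniversal_factor:
  assumes "couniversal B A K P Y u" "W \<in> Obj B" "h \<in> hom A (omap K W) P"
  obtains k where "k \<in> hom B W Y" "u \<cdot>\<^bsub>A\<^esub> amap K k = h"
  using assms unfolding couniversal_def by blast

text \<open>Two couniversal arrows to the same object differ by an isomorphism in the image of the
  functor, so they are invertible together.\<close>

lemma (in cat_functor) couniversal_iso:
  assumes u: "couniversal C D F P Y u" and u': "couniversal C D F P Y' u'" and "iso_arr D u"
  shows "iso_arr D u'"
proof -
  have a: "Y \<in> Obj C" "Y' \<in> Obj C" "u \<in> Arr D" "Dom D u = omap F Y" "Cod D u = P"
    "u' \<in> Arr D" "Dom D u' = omap F Y'" "Cod D u' = P"
    using u u' by (auto simp: couniversal_def hom_def)
  obtain k where "k \<in> hom C Y Y'" and kv: "u' \<cdot>\<^bsub>D\<^esub> amap F k = u"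
    using couniversal_factor[OF u', of Y u] u by (auto simp: couniversal_def)
  then have k: "k \<in> Arr C" "Dom C k = Y" "Cod C k = Y'" by (simp_all add: hom_def)
  obtain m where "m \<in> hom C Y' Y" and mv: "u \<cdot>\<^bsub>D\<^esub> amap F m = u'"
    using couniversal_factor[OF u, of Y' u'] u' by (auto simp: couniversal_def)
  then have m: "m \<in> Arr C" "Dom C m = Y'" "Cod C m = Y" by (simp_all add: hom_def)
  have "u' \<cdot>\<^bsub>D\<^esub> amap F (k \<cdot>\<^bsub>C\<^esub> m) = u'"
    using cod.triangle_Comp[OF kv, of "amap F m"] mv a k m by simp
  moreover have "u' \<cdot>\<^bsub>D\<^esub> amap F (Id C Y') = u'" using a by simp
  moreover have "k \<cdot>\<^bsub>C\<^esub> m \<in> hom C Y' Y'" "Id C Y' \<in> hom C Y' Y'"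
    using a k m by (simp_all add: hom_def)
  moreover have "\<exists>!l. l \<in> hom C Y' Y' \<and> u' \<cdot>\<^bsub>D\<^esub> amap F l = u'"
    using u' by (auto simp: couniversal_def)
  ultimately have km: "k \<cdot>\<^bsub>C\<^esub> m = Id C Y'" by blast
  obtain w where w: "w \<in> Arr D" "Dom D w = Cod D u" "Cod D w = Dom D u"
    "w \<cdot>\<^bsub>D\<^esub> u = Id D (Dom D u)" "u \<cdot>\<^bsub>D\<^esub> w = Id D (Cod D u)" using assms(3) by (rule iso_arrE)
  have "w \<cdot>\<^bsub>D\<^esub> u' = amap F m"
    using cod.triangle_Comp[OF w(4), of "amap F m"] mv w(1-3) a m by simp
  then have "(amap F k \<cdot>\<^bsub>D\<^esub> w) \<cdot>\<^bsub>D\<^esub> u' = Id D (omap F Y')"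
    using amap_triangle[OF km] w(1-3) a k m by simp
  moreover have "u' \<cdot>\<^bsub>D\<^esub> (amap F k \<cdot>\<^bsub>D\<^esub> w) = Id D P"
    using cod.triangle_Comp[OF kv, of w] w a k by simp
  ultimately show ?thesis
    using w(1-3) a k by (intro iso_arrI[of u' D "amap F k \<cdot>\<^bsub>D\<^esub> w"]) simp_all
qed

context adjunction
begin

lemma unit_arr [simp]:
  "Y \<in> Obj B \<Longrightarrow> eta Y \<in> Arr B" "Y \<in> Obj B \<Longrightarrow> Dom B (eta Y) = Y"
  "Y \<in> Obj B \<Longrightarrow> Cod B (eta Y) = omap R (omap L Y)"
  using nat_trans_arr[OF unit] by (simp_all add: id_func_def comp_func_def)

lemma counit_arr [simp]:
  "X \<in> Obj A \<Longrightarrow> epsilon X \<in> Arr A" "X \<in> Obj A \<Longrightarrow> Dom A (epsilon X) = omap L (omap R X)"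
  "X \<in> Obj A \<Longrightarrow> Cod A (epsilon X) = X"
  using nat_trans_arr[OF counit] by (simp_all add: id_func_def comp_func_def)

lemma unit_square:
  "f \<in> Arr B \<Longrightarrow> eta (Cod B f) \<cdot>\<^bsub>B\<^esub> f = amap R (amap L f) \<cdot>\<^bsub>B\<^esub> eta (Dom B f)"
  using nat_trans_square[OF unit] by (simp add: id_func_def comp_func_def)

lemma counit_square:
  "f \<in> Arr A \<Longrightarrow> epsilon (Cod A f) \<cdot>\<^bsub>A\<^esub> amap L (amap R f) = f \<cdot>\<^bsub>A\<^esub> epsilon (Dom A f)"
  using nat_trans_square[OF counit] by (simp add: id_func_def comp_func_def)

lemma transpose_counit:
  assumes "h \<in> Arr B" "X \<in> Obj A" "Cod B h = omap R X" "Dom B h = Y"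
  shows "amap R (epsilon X \<cdot>\<^bsub>A\<^esub> amap L h) \<cdot>\<^bsub>B\<^esub> eta Y = h"
proof -
  have Y: "Y \<in> Obj B" using assms by auto
  have "amap R (epsilon X \<cdot>\<^bsub>A\<^esub> amap L h) \<cdot>\<^bsub>B\<^esub> eta Y =
      amap R (epsilon X) \<cdot>\<^bsub>B\<^esub> (amap R (amap L h) \<cdot>\<^bsub>B\<^esub> eta Y)"
    using assms Y by simp
  also have "\<dots> = amap R (epsilon X) \<cdot>\<^bsub>B\<^esub> (eta (omap R X) \<cdot>\<^bsub>B\<^esub> h)"
    using unit_square[of h] assms by simp
  also have "\<dots> = h"
    using L.dom.triangle_Comp[OF triangle_R, of X h] assms by simp
  finally show ?thesis .
qed

lemma transpose_unit:
  assumes "f \<in> Arr A" "Y \<in> Obj B" "Dom A f = omap L Y" "Cod A f = X"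
  shows "epsilon X \<cdot>\<^bsub>A\<^esub> amap L (amap R f \<cdot>\<^bsub>B\<^esub> eta Y) = f"
proof -
  have X: "X \<in> Obj A" using assms by auto
  have "epsilon X \<cdot>\<^bsub>A\<^esub> amap L (amap R f \<cdot>\<^bsub>B\<^esub> eta Y) =
      f \<cdot>\<^bsub>A\<^esub> (epsilon (omap L Y) \<cdot>\<^bsub>A\<^esub> amap L (eta Y))"
    using L.cod.square_Comp[OF counit_square[of f], of "amap L (eta Y)"] assms X by simp
  also have "\<dots> = f" using triangle_L[of Y] assms by simp
  finally show ?thesis .
qed

lemma transpose_inject:
  assumes "h \<in> Arr B" "k \<in> Arr B" "X \<in> Obj A" "Cod B h = omap R X" "Cod B k = omap R X"
    "Dom B h = Dom B k"
  shows "epsilon X \<cdot>\<^bsub>A\<^esub> amap L h = epsilon X \<cdot>\<^bsub>A\<^esub> amap L k \<longleftrightarrow> h = k"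
  using transpose_counit[of h X "Dom B h"] transpose_counit[of k X "Dom B k"] assms by metis

lemma counit_couniversal:
  assumes X: "X \<in> Obj A"
  shows "couniversal B A L X (omap R X) (epsilon X)"
  unfolding couniversal_def
proof (intro conjI ballI)
  fix W h assume W: "W \<in> Obj B" and "h \<in> hom A (omap L W) X"
  then have h: "h \<in> Arr A" "Dom A h = omap L W" "Cod A h = X" by (simp_all add: hom_def)
  show "\<exists>!k. k \<in> hom B W (omap R X) \<and> epsilon X \<cdot>\<^bsub>A\<^esub> amap L k = h"
  proof (rule ex1I[of _ "amap R h \<cdot>\<^bsub>B\<^esub> eta W"])
    show "amap R h \<cdot>\<^bsub>B\<^esub> eta W \<in> hom B W (omap R X) \<and>
        epsilon X \<cdot>\<^bsub>A\<^esub> amap L (amap R h \<cdot>\<^bsub>B\<^esub> eta W) = h"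
      using transpose_unit[of h W X] W h by (simp add: hom_def)
  next
    fix k assume "k \<in> hom B W (omap R X) \<and> epsilon X \<cdot>\<^bsub>A\<^esub> amap L k = h"
    then show "k = amap R h \<cdot>\<^bsub>B\<^esub> eta W"
      using transpose_counit[of k X W] X by (auto simp: hom_def)
  qed
qed (use X in \<open>simp_all add: hom_def\<close>)

text \<open>Under transposition the action of \<open>R\<close> on arrows becomes precomposition with the counit.
  Conversely, fullness at the unit component \<open>eta (omap R X)\<close> yields a candidate inverse of the
  counit at \<open>X\<close>, and the triangle identities together with faithfulness make it one.\<close>

lemma full_faithful_iff_counit_iso:
  "full A B R \<and> faithful A R \<longleftrightarrow> (\<forall>X \<in> Obj A. iso_arr A (epsilon X))"
proof
  assume ff: "full A B R \<and> faithful A R"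
  show "\<forall>X \<in> Obj A. iso_arr A (epsilon X)"
  proof
    fix X assume X: "X \<in> Obj A"
    let ?LX = "omap L (omap R X)"
    have "eta (omap R X) \<in> amap R ` hom A X ?LX"
      using ff X by (simp add: full_def hom_def)
    then obtain g where g: "g \<in> Arr A" "Dom A g = X" "Cod A g = ?LX" "amap R g = eta (omap R X)"
      by (auto simp: hom_def)
    have image: "amap R (epsilon X \<cdot>\<^bsub>A\<^esub> g) = amap R (Id A X)"
      using triangle_R[OF X] X g by simp
    have "inj_on (amap R) (hom A X X)" using ff X by (simp add: faithful_def)
    from inj_onD[OF this image] have "epsilon X \<cdot>\<^bsub>A\<^esub> g = Id A X"
      using X g(1-3) by (simp add: hom_def)
    moreover have "g \<cdot>\<^bsub>A\<^esub> epsilon X = Id A ?LX"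
      using counit_square[of g] triangle_L[of "omap R X"] X g by simp
    ultimately show "iso_arr A (epsilon X)"
      using X g by (intro iso_arrI[of _ _ g]) simp_all
  qed
next
  assume iso: "\<forall>X \<in> Obj A. iso_arr A (epsilon X)"
  have "inj_on (amap R) (hom A X Y)" if XY: "X \<in> Obj A" "Y \<in> Obj A" for X Y
  proof (rule inj_onI)
    fix f f' assume f: "f \<in> hom A X Y" "f' \<in> hom A X Y" "amap R f = amap R f'"
    obtain w where w: "w \<in> Arr A" "Dom A w = X" "Cod A w = omap L (omap R X)"
      "epsilon X \<cdot>\<^bsub>A\<^esub> w = Id A X" using iso XY by (auto elim!: iso_arrE)
    have "(k \<cdot>\<^bsub>A\<^esub> epsilon X) \<cdot>\<^bsub>A\<^esub> w = k" if "k \<in> hom A X Y" for k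
      using that w XY by (simp add: hom_def)
    moreover have "f \<cdot>\<^bsub>A\<^esub> epsilon X = f' \<cdot>\<^bsub>A\<^esub> epsilon X"
      using f counit_square[of f] counit_square[of f'] by (simp add: hom_def)
    ultimately show "f = f'" using f by metis
  qed
  moreover have "amap R ` hom A X Y = hom B (omap R X) (omap R Y)"
    if XY: "X \<in> Obj A" "Y \<in> Obj A" for X Y
  proof (intro equalityI subsetI)
    fix h assume "h \<in> hom B (omap R X) (omap R Y)"
    then have h: "h \<in> Arr B" "Dom B h = omap R X" "Cod B h = omap R Y"
      by (simp_all add: hom_def)
    obtain w where w: "w \<in> Arr A" "Dom A w = X" "Cod A w = omap L (omap R X)"
      "w \<cdot>\<^bsub>A\<^esub> epsilon X = Id A (omap L (omap R X))" using iso XY by (auto elim!: iso_arrE)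
    let ?t = "epsilon Y \<cdot>\<^bsub>A\<^esub> amap L h"
    let ?f = "?t \<cdot>\<^bsub>A\<^esub> w"
    have f: "?f \<in> hom A X Y" using h w XY by (simp add: hom_def)
    have "?f \<cdot>\<^bsub>A\<^esub> epsilon X = ?t"
      using h w XY by simp
    then have "epsilon Y \<cdot>\<^bsub>A\<^esub> amap L (amap R ?f) = ?t"
      using counit_square[of ?f] f by (simp add: hom_def)
    then have "amap R ?f = h"
      using transpose_inject[of "amap R ?f" h Y] f h XY by (simp add: hom_def)
    then show "h \<in> amap R ` hom A X Y" using f by (metis image_eqI)
  qed (auto simp: hom_def)
  ultimately show "full A B R \<and> faithful A R" by (simp add: full_def faithful_def)
qed

end

section \<open>Comonads and their coalgebras\<close>

context comonad_on
begin

lemma comult_arr [simp]: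
  "X \<in> Obj A \<Longrightarrow> comult G X \<in> Arr A" "X \<in> Obj A \<Longrightarrow> Dom A (comult G X) = omap (cfun G) X"
  "X \<in> Obj A \<Longrightarrow> Cod A (comult G X) = omap (cfun G) (omap (cfun G) X)"
  using nat_trans_arr[OF comult] by (simp_all add: comp_func_def)

lemma counit_arr [simp]:
  "X \<in> Obj A \<Longrightarrow> counit G X \<in> Arr A" "X \<in> Obj A \<Longrightarrow> Dom A (counit G X) = omap (cfun G) X"
  "X \<in> Obj A \<Longrightarrow> Cod A (counit G X) = X"
  using nat_trans_arr[OF counit] by (simp_all add: id_func_def)

lemma counit_square:
  "f \<in> Arr A \<Longrightarrow> counit G (Cod A f) \<cdot>\<^bsub>A\<^esub> amap (cfun G) f = f \<cdot>\<^bsub>A\<^esub> counit G (Dom A f)"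
  using nat_trans_square[OF counit] by (simp add: id_func_def)

lemma coalgebraD:
  assumes "(X, x) \<in> coalgebras A G"
  shows "X \<in> Obj A" "x \<in> Arr A" "Dom A x = X" "Cod A x = omap (cfun G) X"
    "amap (cfun G) x \<cdot>\<^bsub>A\<^esub> x = comult G X \<cdot>\<^bsub>A\<^esub> x" "counit G X \<cdot>\<^bsub>A\<^esub> x = Id A X"
  using assms by (auto simp: coalgebras_def hom_def)

lemma cofree_coalgebra: "X \<in> Obj A \<Longrightarrow> (omap (cfun G) X, comult G X) \<in> coalgebras A G"
  using coassoc counit_left by (simp add: coalgebras_def hom_def)

text \<open>Counit components split the fork of a coalgebra into its cofree coalgebras.\<close>

lemma coalgebra_equalizer:
  assumes "(X, x) \<in> coalgebras A G"
  shows "is_equalizer A (comult G X) (amap (cfun G) x) x"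
proof -
  note x = coalgebraD[OF assms]
  \<comment> \<open>The splitting retracts \<open>comult\<close>, not \<open>G x\<close>, so the pair is taken in the opposite order.\<close>
  have "is_equalizer A (amap (cfun G) x) (comult G X) x"
    using x counit_left[of X] counit_square[of x]
    by (intro dom.split_equalizer[where r = "counit G X" and s = "counit G (omap (cfun G) X)"])
      (simp_all add: hom_def)
  then show ?thesis unfolding is_equalizer_def by (auto simp: hom_def)
qed

lemma hom_coalg_cat:
  "(P, f, Q) \<in> hom (coalg_cat A G) (X, x) (Y, y) \<longleftrightarrow> P = (X, x) \<and> Q = (Y, y) \<and>
    (X, x) \<in> coalgebras A G \<and> (Y, y) \<in> coalgebras A G \<and> f \<in> hom A X Y \<and>
    amap (cfun G) f \<cdot>\<^bsub>A\<^esub> x = y \<cdot>\<^bsub>A\<^esub> f"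
  by (auto simp: coalg_cat_def hom_def)

lemma coalg_iso_iff:
  assumes f: "((X, x), f, (Y, y)) \<in> Arr (coalg_cat A G)"
  shows "iso_arr (coalg_cat A G) ((X, x), f, (Y, y)) \<longleftrightarrow> iso_arr A f"
proof -
  have f': "(X, x) \<in> coalgebras A G" "(Y, y) \<in> coalgebras A G" "f \<in> Arr A" "Dom A f = X"
    "Cod A f = Y" "amap (cfun G) f \<cdot>\<^bsub>A\<^esub> x = y \<cdot>\<^bsub>A\<^esub> f"
    using f by (auto simp: coalg_cat_def hom_def)
  note x = coalgebraD[OF f'(1)] and y = coalgebraD[OF f'(2)]
  have hom: "amap (cfun G) g \<cdot>\<^bsub>A\<^esub> y = x \<cdot>\<^bsub>A\<^esub> g"
    if g: "g \<in> Arr A" "Dom A g = Y" "Cod A g = X" "g \<cdot>\<^bsub>A\<^esub> f = Id A X" "f \<cdot>\<^bsub>A\<^esub> g = Id A Y" for g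
  proof -
    have "amap (cfun G) g \<cdot>\<^bsub>A\<^esub> y = amap (cfun G) g \<cdot>\<^bsub>A\<^esub> (y \<cdot>\<^bsub>A\<^esub> (f \<cdot>\<^bsub>A\<^esub> g))"
      using g y by simp
    also have "\<dots> = amap (cfun G) g \<cdot>\<^bsub>A\<^esub> (amap (cfun G) f \<cdot>\<^bsub>A\<^esub> (x \<cdot>\<^bsub>A\<^esub> g))"
      using dom.square_Comp[OF f'(6), of g] f' g(1-3) x y by simp
    also have "\<dots> = x \<cdot>\<^bsub>A\<^esub> g"
      using dom.triangle_Comp[OF amap_triangle[OF g(4)], of "x \<cdot>\<^bsub>A\<^esub> g"] f' g(1-3) x by simp
    finally show ?thesis .
  qed
  show ?thesis
  proof
    assume "iso_arr (coalg_cat A G) ((X, x), f, (Y, y))"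
    then show "iso_arr A f"
      using f' by (auto simp: iso_arr_def coalg_cat_def hom_def)
  next
    assume "iso_arr A f"
    then obtain g where g: "g \<in> Arr A" "Dom A g = Y" "Cod A g = X" "g \<cdot>\<^bsub>A\<^esub> f = Id A X"
      "f \<cdot>\<^bsub>A\<^esub> g = Id A Y" using f' by (auto elim!: iso_arrE)
    then show "iso_arr (coalg_cat A G) ((X, x), f, (Y, y))"
      using f f' hom[OF g]
      by (intro iso_arrI[of _ _ "((Y, y), g, (X, x))"]) (auto simp: coalg_cat_def hom_def)
  qed
qed

end

lemma (in adjunction) adj_comonad_on: "comonad_on A (adj_comonad L R eta epsilon)"
proof -
  let ?H = "adj_comonad L R eta epsilon"
  have H: "cfun ?H = L \<circ>\<^sub>F R" "comult ?H = (\<lambda>X. amap L (eta (omap R X)))"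
    "comonad.counit ?H = epsilon"
    by (simp_all add: adj_comonad_def)
  have sq: "amap L (eta (omap R Y)) \<cdot>\<^bsub>A\<^esub> amap L (amap R f) =
      amap L (amap R (amap L (amap R f))) \<cdot>\<^bsub>A\<^esub> amap L (eta (omap R X))"
    if "f \<in> hom A X Y" for f X Y
    using L.amap_triangle[OF unit_square[of "amap R f"]] that by (auto simp: hom_def)
  show ?thesis
  proof (unfold_locales, unfold H)
    show "nat_trans A A (L \<circ>\<^sub>F R) ((L \<circ>\<^sub>F R) \<circ>\<^sub>F (L \<circ>\<^sub>F R)) (\<lambda>X. amap L (eta (omap R X)))"
      using sq by (auto simp: nat_trans_def comp_func_def hom_def)
    show "nat_trans A A (L \<circ>\<^sub>F R) id_func epsilon" by (rule counit)
  next
    fix X assume X: "X \<in> Obj A"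
    show "amap (L \<circ>\<^sub>F R) (amap L (eta (omap R X))) \<cdot>\<^bsub>A\<^esub> amap L (eta (omap R X)) =
        amap L (eta (omap R (omap (L \<circ>\<^sub>F R) X))) \<cdot>\<^bsub>A\<^esub> amap L (eta (omap R X))"
      using L.amap_triangle[OF unit_square[of "eta (omap R X)"]] X by (simp add: comp_func_def)
    show "epsilon (omap (L \<circ>\<^sub>F R) X) \<cdot>\<^bsub>A\<^esub> amap L (eta (omap R X)) = Id A (omap (L \<circ>\<^sub>F R) X)"
      using triangle_L[of "omap R X"] X by (simp add: comp_func_def)
    show "amap (L \<circ>\<^sub>F R) (epsilon X) \<cdot>\<^bsub>A\<^esub> amap L (eta (omap R X)) = Id A (omap (L \<circ>\<^sub>F R) X)"
      using L.amap_triangle[OF triangle_R[OF X]] X by (simp add: comp_func_def)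
  qed (auto simp: comp_func_def hom_def)
qed

lemma comonad_morphism_arr:
  assumes "comonad_morphism A H G phi" "X \<in> Obj A"
  shows "phi X \<in> Arr A" "Dom A (phi X) = omap (cfun H) X" "Cod A (phi X) = omap (cfun G) X"
  using assms nat_trans_arr[of A A "cfun H" "cfun G" phi X] by (auto simp: comonad_morphism_def)

lemma comonad_morphism_square:
  assumes "comonad_morphism A H G phi" "f \<in> Arr A"
  shows "phi (Cod A f) \<cdot>\<^bsub>A\<^esub> amap (cfun H) f = amap (cfun G) f \<cdot>\<^bsub>A\<^esub> phi (Dom A f)"
  using assms nat_trans_square[of A A "cfun H" "cfun G" phi f] by (auto simp: comonad_morphism_def)

text \<open>The componentwise inverse of a comonad morphism is again natural and compatible with
  comultiplication and counit.\<close>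

lemma comonad_iso_iff:
  assumes H: "comonad_on A H" and G: "comonad_on A G" and phi: "comonad_morphism A H G phi"
  shows "comonad_iso A H G phi \<longleftrightarrow> (\<forall>X \<in> Obj A. iso_arr A (phi X))"
proof -
  interpret H: comonad_on A H by (rule H)
  interpret G: comonad_on A G by (rule G)
  note phi_arr [simp] = comonad_morphism_arr[OF phi]
  have phi_comult: "comult G X \<cdot>\<^bsub>A\<^esub> phi X =
      phi (omap (cfun G) X) \<cdot>\<^bsub>A\<^esub> (amap (cfun H) (phi X) \<cdot>\<^bsub>A\<^esub> comult H X)"
    and phi_counit: "counit G X \<cdot>\<^bsub>A\<^esub> phi X = counit H X" if "X \<in> Obj A" for X
    using phi that by (simp_all add: comonad_morphism_def)
  show ?thesis
  proof
    assume "comonad_iso A H G phi"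
    then obtain psi where psi: "comonad_morphism A G H psi"
      and inv: "\<And>X. X \<in> Obj A \<Longrightarrow> psi X \<cdot>\<^bsub>A\<^esub> phi X = Id A (omap (cfun H) X)"
        "\<And>X. X \<in> Obj A \<Longrightarrow> phi X \<cdot>\<^bsub>A\<^esub> psi X = Id A (omap (cfun G) X)"
      unfolding comonad_iso_def by blast
    then show "\<forall>X \<in> Obj A. iso_arr A (phi X)"
      using comonad_morphism_arr[OF psi] by (auto intro!: iso_arrI[of _ _ "psi _"])
  next
    assume iso: "\<forall>X \<in> Obj A. iso_arr A (phi X)"
    have "\<forall>X \<in> Obj A. \<exists>g. g \<in> Arr A \<and> Dom A g = omap (cfun G) X \<and> Cod A g = omap (cfun H) X \<and>
        g \<cdot>\<^bsub>A\<^esub> phi X = Id A (omap (cfun H) X) \<and> phi X \<cdot>\<^bsub>A\<^esub> g = Id A (omap (cfun G) X)"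
    proof
      fix X assume X: "X \<in> Obj A"
      with iso have "iso_arr A (phi X)" by blast
      then show "\<exists>g. g \<in> Arr A \<and> Dom A g = omap (cfun G) X \<and> Cod A g = omap (cfun H) X \<and>
          g \<cdot>\<^bsub>A\<^esub> phi X = Id A (omap (cfun H) X) \<and> phi X \<cdot>\<^bsub>A\<^esub> g = Id A (omap (cfun G) X)"
        by (rule iso_arrE) (use X in auto)
    qed
    then obtain psi where psi [simp]: "\<And>X. X \<in> Obj A \<Longrightarrow> psi X \<in> Arr A"
        "\<And>X. X \<in> Obj A \<Longrightarrow> Dom A (psi X) = omap (cfun G) X"
        "\<And>X. X \<in> Obj A \<Longrightarrow> Cod A (psi X) = omap (cfun H) X"
      and inv: "\<And>X. X \<in> Obj A \<Longrightarrow> psi X \<cdot>\<^bsub>A\<^esub> phi X = Id A (omap (cfun H) X)"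
        "\<And>X. X \<in> Obj A \<Longrightarrow> phi X \<cdot>\<^bsub>A\<^esub> psi X = Id A (omap (cfun G) X)"
      by metis
    have psi_square: "psi (Cod A f) \<cdot>\<^bsub>A\<^esub> amap (cfun G) f = amap (cfun H) f \<cdot>\<^bsub>A\<^esub> psi (Dom A f)"
      if f: "f \<in> Arr A" for f
    proof -
      let ?X = "Dom A f" and ?Y = "Cod A f"
      have "phi ?Y \<cdot>\<^bsub>A\<^esub> (amap (cfun H) f \<cdot>\<^bsub>A\<^esub> psi ?X) =
          amap (cfun G) f \<cdot>\<^bsub>A\<^esub> (phi ?X \<cdot>\<^bsub>A\<^esub> psi ?X)"
        using H.dom.square_Comp[OF comonad_morphism_square[OF phi f], of "psi ?X"] f by simp
      also have "\<dots> = phi ?Y \<cdot>\<^bsub>A\<^esub> (psi ?Y \<cdot>\<^bsub>A\<^esub> amap (cfun G) f)"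
        using H.dom.triangle_Comp[OF inv(2), of ?Y "amap (cfun G) f"] inv f by simp
      finally show ?thesis
        using H.dom.iso_cancel[of "phi ?Y" "amap (cfun H) f \<cdot>\<^bsub>A\<^esub> psi ?X"
            "psi ?Y \<cdot>\<^bsub>A\<^esub> amap (cfun G) f"] iso f by simp
    qed
    have "comult H X \<cdot>\<^bsub>A\<^esub> psi X =
        (psi (omap (cfun H) X) \<cdot>\<^bsub>A\<^esub> amap (cfun G) (psi X)) \<cdot>\<^bsub>A\<^esub> comult G X"
      if X: "X \<in> Obj A" for X
    proof -
      let ?H = "amap (cfun H)" and ?GX = "omap (cfun G) X" and ?HX = "omap (cfun H) X"
      let ?c = "comult H X \<cdot>\<^bsub>A\<^esub> psi X"
      have "comult G X = (comult G X \<cdot>\<^bsub>A\<^esub> phi X) \<cdot>\<^bsub>A\<^esub> psi X"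
        using inv(2)[OF X] X by simp
      also have "\<dots> = phi ?GX \<cdot>\<^bsub>A\<^esub> (?H (phi X) \<cdot>\<^bsub>A\<^esub> ?c)"
        unfolding phi_comult[OF X] using X by simp
      finally have comult_G: "comult G X = phi ?GX \<cdot>\<^bsub>A\<^esub> (?H (phi X) \<cdot>\<^bsub>A\<^esub> ?c)" .
      have "(psi ?HX \<cdot>\<^bsub>A\<^esub> amap (cfun G) (psi X)) \<cdot>\<^bsub>A\<^esub> comult G X =
          psi ?HX \<cdot>\<^bsub>A\<^esub> (amap (cfun G) (psi X) \<cdot>\<^bsub>A\<^esub> comult G X)"
        using X by simp
      also have "\<dots> = ?H (psi X) \<cdot>\<^bsub>A\<^esub> (psi ?GX \<cdot>\<^bsub>A\<^esub> comult G X)"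
        using H.dom.square_Comp[OF psi_square[of "psi X"], of "comult G X"] X by simp
      also have "psi ?GX \<cdot>\<^bsub>A\<^esub> comult G X = ?H (phi X) \<cdot>\<^bsub>A\<^esub> ?c"
        unfolding comult_G
        using H.dom.triangle_Comp[OF inv(1), of ?GX "?H (phi X) \<cdot>\<^bsub>A\<^esub> ?c"] X by simp
      also have "?H (psi X) \<cdot>\<^bsub>A\<^esub> (?H (phi X) \<cdot>\<^bsub>A\<^esub> ?c) = ?c"
        using H.dom.triangle_Comp[OF H.amap_triangle[OF inv(1)], of X ?c] X by simp
      finally show ?thesis by simp
    qed
    moreover have "counit H X \<cdot>\<^bsub>A\<^esub> psi X = counit G X" if X: "X \<in> Obj A" for X
      using H.dom.triangle_Comp[OF phi_counit, of X "psi X"] inv(2)[OF X] X by simp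
    moreover have "nat_trans A A (cfun G) (cfun H) psi"
      using psi_square by (auto simp: nat_trans_def hom_def)
    ultimately have "comonad_morphism A G H psi" by (simp add: comonad_morphism_def)
    then show "comonad_iso A H G phi" unfolding comonad_iso_def using phi inv by blast
  qed
qed

section \<open>The comparison functor\<close>

locale comparison = adj: adjunction B A L R eta epsilon + com: comonad_on A G
  for A :: "('a, 'f) cat" and B :: "('b, 'g) cat"
    and L :: "('b, 'g, 'a, 'f) func" and R :: "('a, 'f, 'b, 'g) func"
    and eta :: "'b \<Rightarrow> 'g" and epsilon :: "'a \<Rightarrow> 'f" and G :: "('a, 'f) comonad" +
  fixes phi :: "'a \<Rightarrow> 'f"
    and K :: "('b, 'g, 'a \<times> 'f, ('a \<times> 'f) \<times> 'f \<times> ('a \<times> 'f)) func"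
  assumes phi: "comonad_morphism A (adj_comonad L R eta epsilon) G phi"
    and K_functor: "cat_functor B (coalg_cat A G) K"
    and K_phi: "func_eq B K (K_func B A L eta phi)"
begin

abbreviation "AG \<equiv> coalg_cat A G"
abbreviation "Ga \<equiv> amap (cfun G)"
abbreviation "Go \<equiv> omap (cfun G)"
abbreviation "al \<equiv> alpha B R eta phi"

sublocale K: cat_functor B AG K by (rule K_functor)

lemma phi_arr [simp]:
  "X \<in> Obj A \<Longrightarrow> phi X \<in> Arr A" "X \<in> Obj A \<Longrightarrow> Dom A (phi X) = omap L (omap R X)"
  "X \<in> Obj A \<Longrightarrow> Cod A (phi X) = Go X"
  using comonad_morphism_arr[OF phi] by (simp_all add: adj_comonad_def comp_func_def)

lemma phi_square:
  "f \<in> Arr A \<Longrightarrow> phi (Cod A f) \<cdot>\<^bsub>A\<^esub> amap L (amap R f) = Ga f \<cdot>\<^bsub>A\<^esub> phi (Dom A f)"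
  using comonad_morphism_square[OF phi] by (simp add: adj_comonad_def comp_func_def)

lemma alpha_arr [simp]:
  "X \<in> Obj A \<Longrightarrow> al X \<in> Arr B" "X \<in> Obj A \<Longrightarrow> Dom B (al X) = omap R X"
  "X \<in> Obj A \<Longrightarrow> Cod B (al X) = omap R (Go X)"
  by (simp_all add: alpha_def)

lemma phi_comult:
  assumes X: "X \<in> Obj A"
  shows "comult G X \<cdot>\<^bsub>A\<^esub> phi X = phi (Go X) \<cdot>\<^bsub>A\<^esub> amap L (al X)"
  using phi X by (simp add: comonad_morphism_def adj_comonad_def comp_func_def alpha_def)

lemma phi_counit: "X \<in> Obj A \<Longrightarrow> counit G X \<cdot>\<^bsub>A\<^esub> phi X = epsilon X"
  using phi by (simp add: comonad_morphism_def adj_comonad_def)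

lemma counit_L_alpha: "X \<in> Obj A \<Longrightarrow> epsilon (Go X) \<cdot>\<^bsub>A\<^esub> amap L (al X) = phi X"
  using adj.transpose_unit[of "phi X" "omap R X" "Go X"] by (simp add: alpha_def)

lemma alpha_square:
  assumes "f \<in> Arr A"
  shows "al (Cod A f) \<cdot>\<^bsub>B\<^esub> amap R f = amap R (Ga f) \<cdot>\<^bsub>B\<^esub> al (Dom A f)"
proof -
  let ?X = "Dom A f" and ?Y = "Cod A f"
  have "al ?Y \<cdot>\<^bsub>B\<^esub> amap R f = amap R (phi ?Y) \<cdot>\<^bsub>B\<^esub> (amap R (amap L (amap R f)) \<cdot>\<^bsub>B\<^esub> eta (omap R ?X))"
    using adj.unit_square[of "amap R f"] assms by (simp add: alpha_def)
  also have "\<dots> = amap R (Ga f) \<cdot>\<^bsub>B\<^esub> al ?X"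
    using adj.L.dom.square_Comp[of "amap R (phi ?Y)" "amap R (amap L (amap R f))"
        "amap R (Ga f)" "amap R (phi ?X)" "eta (omap R ?X)"]
      adj.R.amap_triangle[OF phi_square[OF assms]] assms
    by (simp add: alpha_def)
  finally show ?thesis .
qed

text \<open>The arrow \<open>alpha\<close> makes \<open>R\<close> a comodule over the comonad \<open>G\<close>. Its coassociativity is the
  transpose of the compatibility of \<open>phi\<close> with comultiplication, since \<open>alpha\<close> transposes to
  \<open>phi\<close>.\<close>

lemma alpha_comult:
  assumes X: "X \<in> Obj A"
  shows "al (Go X) \<cdot>\<^bsub>B\<^esub> al X = amap R (comult G X) \<cdot>\<^bsub>B\<^esub> al X"
proof -
  have "epsilon (Go (Go X)) \<cdot>\<^bsub>A\<^esub> amap L (al (Go X) \<cdot>\<^bsub>B\<^esub> al X) = phi (Go X) \<cdot>\<^bsub>A\<^esub> amap L (al X)"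
    using adj.L.cod.triangle_Comp[OF counit_L_alpha[of "Go X"], of "amap L (al X)"] X by simp
  also have "\<dots> = comult G X \<cdot>\<^bsub>A\<^esub> (epsilon (Go X) \<cdot>\<^bsub>A\<^esub> amap L (al X))"
    using phi_comult counit_L_alpha X by simp
  also have "\<dots> = epsilon (Go (Go X)) \<cdot>\<^bsub>A\<^esub> amap L (amap R (comult G X) \<cdot>\<^bsub>B\<^esub> al X)"
    using adj.L.cod.square_Comp[OF adj.counit_square[of "comult G X"], of "amap L (al X)"] X by simp
  finally show ?thesis by (subst (asm) adj.transpose_inject) (use X in simp_all)
qed

lemma alpha_counit:
  assumes X: "X \<in> Obj A"
  shows "amap R (counit G X) \<cdot>\<^bsub>B\<^esub> al X = Id B (omap R X)"
  using adj.L.dom.triangle_Comp[OF adj.R.amap_triangle[OF phi_counit], of X "eta (omap R X)"]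
    adj.triangle_R[OF X] X by (simp add: alpha_def)

text \<open>This computes the right adjoint on the cofree coalgebra of \<open>X\<close> as \<open>R X\<close>; the corresponding
  couniversal arrow is \<open>phi X\<close> by \<open>counit_L_alpha\<close>.\<close>

lemma alpha_equalizer:
  assumes X: "X \<in> Obj A"
  shows "is_equalizer B (al (Go X)) (amap R (comult G X)) (al X)"
  using X alpha_comult alpha_counit alpha_square[of "counit G X"]
    adj.R.amap_triangle[OF com.counit_right]
  by (intro adj.L.dom.split_equalizer[where r = "amap R (counit G X)"
        and s = "amap R (Ga (counit G X))"])
    (simp_all add: hom_def)

lemma omap_K: "Y \<in> Obj B \<Longrightarrow> omap K Y = (omap L Y, phi (omap L Y) \<cdot>\<^bsub>A\<^esub> amap L (eta Y))"
  using K_phi by (simp add: func_eq_def K_func_def K_obj_def)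

lemma amap_K: "k \<in> Arr B \<Longrightarrow> amap K k = (omap K (Dom B k), amap L k, omap K (Cod B k))"
  using K_phi by (simp add: func_eq_def K_func_def)

text \<open>Both sides of the coalgebra square for \<open>epsilon X \<cdot> L h\<close> are transposes of arrows into
  \<open>R G X\<close>, namely of the two composites with \<open>h\<close>; hence the pair equalized in the description of
  the right adjoint.\<close>

lemma coalg_hom_iff_equalized:
  assumes X: "(X, x) \<in> coalgebras A G" and h: "h \<in> Arr B" "Cod B h = omap R X" "Dom B h = Y"
  shows "(omap K Y, epsilon X \<cdot>\<^bsub>A\<^esub> amap L h, (X, x)) \<in> hom AG (omap K Y) (X, x) \<longleftrightarrow>
    al X \<cdot>\<^bsub>B\<^esub> h = amap R x \<cdot>\<^bsub>B\<^esub> h"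
proof -
  note x = com.coalgebraD[OF X]
  have Y: "Y \<in> Obj B" using h by auto
  have "omap K Y \<in> coalgebras A G" using K.omap_in[OF Y] by (simp add: coalg_cat_def)
  moreover have "Ga (epsilon X \<cdot>\<^bsub>A\<^esub> amap L h) \<cdot>\<^bsub>A\<^esub> (phi (omap L Y) \<cdot>\<^bsub>A\<^esub> amap L (eta Y)) =
      epsilon (Go X) \<cdot>\<^bsub>A\<^esub> amap L (al X \<cdot>\<^bsub>B\<^esub> h)"
  proof -
    let ?f = "epsilon X \<cdot>\<^bsub>A\<^esub> amap L h"
    have f: "?f \<in> Arr A" "Dom A ?f = omap L Y" "Cod A ?f = X" using h x by simp_all
    have "Ga ?f \<cdot>\<^bsub>A\<^esub> (phi (omap L Y) \<cdot>\<^bsub>A\<^esub> amap L (eta Y)) =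
        phi X \<cdot>\<^bsub>A\<^esub> (amap L (amap R ?f) \<cdot>\<^bsub>A\<^esub> amap L (eta Y))"
      by (rule adj.L.cod.square_Comp[OF phi_square[OF f(1), unfolded f(2,3), symmetric]])
        (use f Y x(1) in \<open>simp_all del: com.amap_Comp_Id adj.R.amap_Comp_Id
          adj.L.amap_Comp_Id adj.L.cod.Comp_arr\<close>)
    also have "\<dots> = phi X \<cdot>\<^bsub>A\<^esub> amap L h"
      using adj.L.amap_triangle[OF adj.transpose_counit[OF h(1) x(1) h(2,3)]] f Y by simp
    also have "\<dots> = epsilon (Go X) \<cdot>\<^bsub>A\<^esub> amap L (al X \<cdot>\<^bsub>B\<^esub> h)"
      using adj.L.cod.triangle_Comp[OF counit_L_alpha, of X "amap L h"] x(1) h by simp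
    finally show ?thesis .
  qed
  moreover have "x \<cdot>\<^bsub>A\<^esub> (epsilon X \<cdot>\<^bsub>A\<^esub> amap L h) = epsilon (Go X) \<cdot>\<^bsub>A\<^esub> amap L (amap R x \<cdot>\<^bsub>B\<^esub> h)"
    using adj.L.cod.square_Comp[OF adj.counit_square[OF x(2)], of "amap L h"] x h by simp
  moreover have "epsilon (Go X) \<cdot>\<^bsub>A\<^esub> amap L (al X \<cdot>\<^bsub>B\<^esub> h) =
      epsilon (Go X) \<cdot>\<^bsub>A\<^esub> amap L (amap R x \<cdot>\<^bsub>B\<^esub> h) \<longleftrightarrow> al X \<cdot>\<^bsub>B\<^esub> h = amap R x \<cdot>\<^bsub>B\<^esub> h"
    by (rule adj.transpose_inject) (use x h in simp_all)
  ultimately show ?thesis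
    using X Y x h by (simp add: omap_K com.hom_coalg_cat) (simp add: hom_def)
qed

text \<open>Factoring the transpose of a coalgebra morphism \<open>K W \<rightarrow> (X, x)\<close> through \<open>d\<close> factors the
  morphism itself through \<open>epsilon X \<cdot> L d\<close>.\<close>

lemma equalizer_couniversal:
  assumes X: "(X, x) \<in> coalgebras A G" and d: "is_equalizer B (al X) (amap R x) d"
  shows "couniversal B AG K (X, x) (Dom B d)
    (omap K (Dom B d), epsilon X \<cdot>\<^bsub>A\<^esub> amap L d, (X, x))" (is "couniversal B AG K _ _ ?u")
proof -
  note x = com.coalgebraD[OF X] and D = adj.L.dom.equalizerD[OF d]
  have d': "Cod B d = omap R X" using D x by simp
  have u: "?u \<in> hom AG (omap K (Dom B d)) (X, x)"
    using coalg_hom_iff_equalized[OF X D(3) d' refl] D by simp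
  have comp: "?u \<cdot>\<^bsub>AG\<^esub> amap K k = (omap K (Dom B k), epsilon X \<cdot>\<^bsub>A\<^esub> amap L (d \<cdot>\<^bsub>B\<^esub> k), (X, x))"
    if "k \<in> Arr B" "Cod B k = Dom B d" for k
    using that D(3) d' x by (simp add: amap_K) (simp add: coalg_cat_def)
  show ?thesis
    unfolding couniversal_def
  proof (intro conjI ballI)
    fix W hh assume W: "W \<in> Obj B" and hh: "hh \<in> hom AG (omap K W) (X, x)"
    obtain P f Q where "hh = (P, f, Q)" by (metis prod_cases3)
    with hh W have f: "hh = (omap K W, f, (X, x))" "f \<in> Arr A" "Dom A f = omap L W" "Cod A f = X"
      by (auto simp: omap_K com.hom_coalg_cat) (auto simp: hom_def)
    let ?h = "amap R f \<cdot>\<^bsub>B\<^esub> eta W"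
    have h: "?h \<in> Arr B" "Dom B ?h = W" "Cod B ?h = omap R X" using f W by simp_all
    have ft: "epsilon X \<cdot>\<^bsub>A\<^esub> amap L ?h = f" using adj.transpose_unit f W by simp
    have "al X \<cdot>\<^bsub>B\<^esub> ?h = amap R x \<cdot>\<^bsub>B\<^esub> ?h"
      using coalg_hom_iff_equalized[OF X h(1,3,2)] hh f(1) ft by simp
    then obtain k where k: "k \<in> Arr B" "Dom B k = W" "Cod B k = Dom B d" "d \<cdot>\<^bsub>B\<^esub> k = ?h"
      using adj.L.dom.equalizer_factor[OF d h(1)] h x by auto
    show "\<exists>!k. k \<in> hom B W (Dom B d) \<and> ?u \<cdot>\<^bsub>AG\<^esub> amap K k = hh"
    proof (rule ex1I[of _ k])
      show "k \<in> hom B W (Dom B d) \<and> ?u \<cdot>\<^bsub>AG\<^esub> amap K k = hh"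
        unfolding comp[OF k(1,3)] k(4) ft f(1) using k by (simp add: hom_def)
    next
      fix l assume "l \<in> hom B W (Dom B d) \<and> ?u \<cdot>\<^bsub>AG\<^esub> amap K l = hh"
      then have l: "l \<in> Arr B" "Dom B l = W" "Cod B l = Dom B d"
        and lu: "?u \<cdot>\<^bsub>AG\<^esub> amap K l = hh" by (simp_all add: hom_def)
      have "epsilon X \<cdot>\<^bsub>A\<^esub> amap L (d \<cdot>\<^bsub>B\<^esub> l) = epsilon X \<cdot>\<^bsub>A\<^esub> amap L (d \<cdot>\<^bsub>B\<^esub> k)"
        using lu[unfolded comp[OF l(1,3)]] f(1) k(4) ft by simp
      then have "d \<cdot>\<^bsub>B\<^esub> l = d \<cdot>\<^bsub>B\<^esub> k"
        using adj.transpose_inject[of "d \<cdot>\<^bsub>B\<^esub> l" "d \<cdot>\<^bsub>B\<^esub> k" X] l k(1-3) D(3) d' x(1)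
        by (simp del: adj.L.amap_Comp_Id)
      then show "l = k" using adj.L.dom.equalizer_mono[OF d] l k by simp
    qed
  qed (use u D in simp_all)
qed

text \<open>Since \<open>phi\<close> identifies the pair \<open>(L alpha, L R x)\<close> with the pair \<open>(comult, G x)\<close>, whose
  equalizer is \<open>x\<close> itself, preservation by \<open>L\<close> amounts to invertibility of the comparison arrow,
  which is the couniversal arrow to \<open>(X, x)\<close>.\<close>

lemma L_equalizer_iff:
  assumes iso: "\<And>X. X \<in> Obj A \<Longrightarrow> iso_arr A (phi X)"
    and X: "(X, x) \<in> coalgebras A G" and d: "is_equalizer B (al X) (amap R x) d"
  shows "is_equalizer A (amap L (al X)) (amap L (amap R x)) (amap L d) \<longleftrightarrow>
    iso_arr A (epsilon X \<cdot>\<^bsub>A\<^esub> amap L d)"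
proof -
  note x = com.coalgebraD[OF X] and D = adj.L.dom.equalizerD[OF d]
  have d': "Cod B d = omap R X" using D x by simp
  have "phi X \<cdot>\<^bsub>A\<^esub> amap L d = epsilon (Go X) \<cdot>\<^bsub>A\<^esub> amap L (al X \<cdot>\<^bsub>B\<^esub> d)"
    using adj.L.cod.triangle_Comp[OF counit_L_alpha, of X "amap L d"] x(1) d' D(3) by simp
  also have "\<dots> = x \<cdot>\<^bsub>A\<^esub> (epsilon X \<cdot>\<^bsub>A\<^esub> amap L d)"
    unfolding D(7)
    using adj.L.cod.square_Comp[OF adj.counit_square[OF x(2)], of "amap L d"] x(1-4) d' D(3) by simp
  finally have "phi X \<cdot>\<^bsub>A\<^esub> amap L d = x \<cdot>\<^bsub>A\<^esub> (epsilon X \<cdot>\<^bsub>A\<^esub> amap L d)" .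
  then show ?thesis
    using phi_square[OF x(2)] phi_comult[OF x(1)] iso x(1-4) d' D(3)
    by (intro adj.L.cod.equalizer_iff_comparison_iso[OF com.coalgebra_equalizer[OF X],
          where u = "phi X" and v = "phi (Go X)"]) (simp_all add: hom_def)
qed

end

theorem mainTheorem5:
  fixes A :: "('a, 'f) cat" and B :: "('b, 'g) cat"
    and L :: "('b, 'g, 'a, 'f) func" and R :: "('a, 'f, 'b, 'g) func"
    and eta :: "'b \<Rightarrow> 'g" and epsilon :: "'a \<Rightarrow> 'f"
    and G :: "('a, 'f) comonad"
    and K :: "('b, 'g, 'a \<times> 'f, ('a \<times> 'f) \<times> 'f \<times> ('a \<times> 'f)) func"
    and phi :: "'a \<Rightarrow> 'f"
    and D :: "('a \<times> 'f, ('a \<times> 'f) \<times> 'f \<times> ('a \<times> 'f), 'b, 'g) func"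
    and eq :: "'a \<times> 'f \<Rightarrow> 'g"
  assumes adj: "adjunction B A L R eta epsilon"
    and comonad: "comonad_on A G"
    and K_functor: "cat_functor B (coalg_cat A G) K"
    and UK: "func_eq B (forget_func \<circ>\<^sub>F K) L"
    and phi: "comonad_morphism A (adj_comonad L R eta epsilon) G phi"
    and K_phi: "func_eq B K (K_func B A L eta phi)"
    and equalizers: "\<And>X x. (X, x) \<in> coalgebras A G \<Longrightarrow>
      \<exists>e. is_equalizer B (alpha B R eta phi X) (amap R x) e"
    and D_adjoint: "right_adjoint B (coalg_cat A G) K D"
    and D_value: "\<And>X x. (X, x) \<in> coalgebras A G \<Longrightarrow>
      Dom B (eq (X, x)) = omap D (X, x) \<and>
      is_equalizer B (alpha B R eta phi X) (amap R x) (eq (X, x))"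
  shows "full (coalg_cat A G) B D \<and> faithful (coalg_cat A G) D \<longleftrightarrow>
    (\<forall>(X, x) \<in> coalgebras A G.
      preserves_equalizer B A L (alpha B R eta phi X) (amap R x) (eq (X, x))) \<and>
    comonad_iso A (adj_comonad L R eta epsilon) G phi"
proof -
  interpret comparison A B L R eta epsilon G phi K
    using adj comonad phi K_functor K_phi
    by (intro comparison.intro comparison_axioms.intro)
  obtain eta' eps' where "adjunction B AG K D eta' eps'"
    using D_adjoint unfolding right_adjoint_def by blast
  then interpret KD: adjunction B AG K D eta' eps' .
  \<comment> \<open>Only the domain of \<open>eq (X, x)\<close> is tied to \<open>D\<close>; couniversality links the equalizer arrow to the
    counit \<open>eps'\<close>, and it does so for every choice \<open>d\<close> of equalizer.\<close>
  have iso_iff: "iso_arr AG (eps' (X, x)) \<longleftrightarrow> iso_arr A (epsilon X \<cdot>\<^bsub>A\<^esub> amap L d)"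
    if X: "(X, x) \<in> coalgebras A G" and d: "is_equalizer B (al X) (amap R x) d" for X x d
  proof -
    let ?u = "(omap K (Dom B d), epsilon X \<cdot>\<^bsub>A\<^esub> amap L d, (X, x))"
    have u: "couniversal B AG K (X, x) (Dom B d) ?u" by (rule equalizer_couniversal[OF X d])
    have c: "couniversal B AG K (X, x) (omap D (X, x)) (eps' (X, x))"
      using KD.counit_couniversal X by (simp add: coalg_cat_def)
    have "iso_arr AG (eps' (X, x)) \<longleftrightarrow> iso_arr AG ?u"
      using K.couniversal_iso[OF u c] K.couniversal_iso[OF c u] by blast
    also have "\<dots> \<longleftrightarrow> iso_arr A (epsilon X \<cdot>\<^bsub>A\<^esub> amap L d)"
      using u com.coalg_iso_iff[of "fst (omap K (Dom B d))" "snd (omap K (Dom B d))"]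
      by (simp add: couniversal_def hom_def)
    finally show ?thesis .
  qed
  \<comment> \<open>The case of the cofree coalgebra of \<open>X\<close>.\<close>
  have phi_iso: "iso_arr A (phi X)"
    if "\<forall>(X, x) \<in> coalgebras A G. iso_arr AG (eps' (X, x))" and X: "X \<in> Obj A" for X
    using that iso_iff[OF com.cofree_coalgebra[OF X] alpha_equalizer[OF X]]
      com.cofree_coalgebra[OF X] counit_L_alpha[OF X] by auto
  have preserves_iff: "preserves_equalizer B A L (al X) (amap R x) (eq (X, x)) \<longleftrightarrow>
      iso_arr AG (eps' (X, x))"
    if iso: "\<And>X. X \<in> Obj A \<Longrightarrow> iso_arr A (phi X)" and X: "(X, x) \<in> coalgebras A G" for X x
  proof -
    have d: "is_equalizer B (al X) (amap R x) (eq (X, x))" using D_value[OF X] by simp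
    show ?thesis
      using L_equalizer_iff[OF iso X d] iso_iff[OF X d] d by (simp add: preserves_equalizer_def)
  qed
  have "full AG B D \<and> faithful AG D \<longleftrightarrow> (\<forall>(X, x) \<in> coalgebras A G. iso_arr AG (eps' (X, x)))"
    unfolding KD.full_faithful_iff_counit_iso by (auto simp: coalg_cat_def)
  also have "\<dots> \<longleftrightarrow> (\<forall>(X, x) \<in> coalgebras A G.
      preserves_equalizer B A L (al X) (amap R x) (eq (X, x))) \<and>
      (\<forall>X \<in> Obj A. iso_arr A (phi X))"
    using phi_iso preserves_iff by fastforce
  finally show ?thesis
    unfolding comonad_iso_iff[OF adj.adj_comonad_on comonad phi] .
qed

end
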